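(* For any connected hypergraph $\mathbb H=(V,\mathcal H)$ and any admissible matching policy $\Phi$, $\mathrm{Stab}(\mathbb H,\Phi)\subset\mathscr N_1(\mathbb H)$, where $\mathscr N_1(\mathbb H)$ is the set of $\mu\in\mathscr M(V)$ such that for every independent set $I$ of $\mathbb H$ that is not $\mu$-minimal, $$\mu(I)<\sum_{H\in\mathcal H}|H\cap I|\min_{k\in H}\mu(k).$$
   Context: A hypergraph $\mathbb H=(V,\mathcal H)$ consists of a finite node set $V$ and a finite set $\mathcal H$ of subsets of $V$ (hyperedges) with union $V$. All hypergraphs are assumed simple (no hyperedge is contained in another one). $\mathbb H$ is connected if the graph whose vertices are the hyperedges, with two hyperedges adjacent when they intersect, is connected. $\mathscr M(V)$ is the set of probability measures $\mu$ on $V$ with $\mu(i)>0$ for all $i$. An independent set is a set $I\subset V$ that contains no hyperedge. The degree of a node is the number of hyperedges containing it. For $B\subset V$, $L_\mu(B)=\arg\min\{\mu(j):j\in B\}$. An independent set $I$ is $\mu$-minimal if the intersection of any hyperedge $H$ with $I$ is either empty or a singleton $\{v_H\}$ such that $v_H$ has degree $1$ and $L_\mu(H)=\{v_H\}$ (i.e. $v_H$ is the only minimizer of $\mu$ on $H$). Matching model $(\mathbb H,\Phi,\mu)$: at each time $n\ge1$ one item enters; its class $C_n\in V$ is drawn from $\mu$, i.i.d. If the buffer contains a set of items whose classes form, together with $C_n$, a hyperedge (one item per class), the policy $\Phi$ selects one such set and these items leave immediately together with the incoming item (a match is always performed whenever possible); otherwise the incoming item is stored. $W_n$ is the word over $V$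 listing the classes of unmatched items after the arrival at time $n$, in order of arrival; it takes values in the set of words in which, for each hyperedge, some class of the hyperedge does not occur. $\Phi$ is admissible if the choice of the match depends solely on the queue detail (the word) upon arrival and the incoming class, and possibly on an independent uniform draw in case of a tie; then $(W_n)$ is a Markov chain. The model is stable if $(W_n)$ is positive recurrent; $\mathrm{Stab}(\mathbb H,\Phi)$ is the set of $\mu\in\mathscr M(V)$ for which it is stable. *)

theory Defs
  imports "HOL-Probability.Probability"
begin

definition hypergraph :: "'a set \<Rightarrow> 'a set set \<Rightarrow> bool" where
  "hypergraph V E \<longleftrightarrow>
     finite V \<and> finite E \<and> \<Union>E = V \<and> (\<forall>H\<in>E. \<forall>K\<in>E. H \<subseteq> K \<longrightarrow> H = K)"

definition hyperedge_graph :: "'a set set \<Rightarrow> ('a set \<times> 'a set) set" where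
  "hyperedge_graph E = {(H, K). H \<in> E \<and> K \<in> E \<and> H \<inter> K \<noteq> {}}"

definition connected_hypergraph :: "'a set set \<Rightarrow> bool" where
  "connected_hypergraph E \<longleftrightarrow> (\<forall>H\<in>E. \<forall>K\<in>E. (H, K) \<in> (hyperedge_graph E)\<^sup>*)"

definition independent_set :: "'a set \<Rightarrow> 'a set set \<Rightarrow> 'a set \<Rightarrow> bool" where
  "independent_set V E I \<longleftrightarrow> I \<subseteq> V \<and> (\<forall>H\<in>E. \<not> H \<subseteq> I)"

definition degree :: "'a set set \<Rightarrow> 'a \<Rightarrow> nat" where
  "degree E v = card {H \<in> E. v \<in> H}"

text \<open>The probability measures on the finite set \<open>V\<close> charging every node.\<close>

definition full_support_measures :: "'a set \<Rightarrow> 'a pmf set" where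
  "full_support_measures V = {\<mu>. set_pmf \<mu> = V}"

definition minimizers :: "'a pmf \<Rightarrow> 'a set \<Rightarrow> 'a set" where
  "minimizers \<mu> B = {j. is_arg_min (pmf \<mu>) (\<lambda>k. k \<in> B) j}"

definition mu_minimal :: "'a set \<Rightarrow> 'a set set \<Rightarrow> 'a pmf \<Rightarrow> 'a set \<Rightarrow> bool" where
  "mu_minimal V E \<mu> I \<longleftrightarrow> independent_set V E I \<and>
     (\<forall>H\<in>E. H \<inter> I = {} \<or>
        (\<exists>v. H \<inter> I = {v} \<and> degree E v = 1 \<and> minimizers \<mu> H = {v}))"

definition N1 :: "'a set \<Rightarrow> 'a set set \<Rightarrow> 'a pmf set" where
  "N1 V E = {\<mu> \<in> full_support_measures V.
     \<forall>I. independent_set V E I \<and> \<not> mu_minimal V E \<mu> I \<longrightarrow>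
       measure_pmf.prob \<mu> I < (\<Sum>H\<in>E. real (card (H \<inter> I)) * Min (pmf \<mu> ` H))}"

text \<open>
  The buffer is the word of the classes of the stored items, in order of arrival. Stored items
  are referred to by their positions in this word, since several of them may share a class.
\<close>

definition buffer_words :: "'a set \<Rightarrow> 'a set set \<Rightarrow> 'a list set" where
  "buffer_words V E = {w. set w \<subseteq> V \<and> (\<forall>H\<in>E. \<exists>k\<in>H. k \<notin> set w)}"

definition possible_matches :: "'a set set \<Rightarrow> 'a list \<Rightarrow> 'a \<Rightarrow> nat set set" where
  "possible_matches E w c =
     {S. S \<subseteq> {..<length w} \<and> inj_on ((!) w) S \<and> c \<notin> (!) w ` S \<and> insert c ((!) w ` S) \<in> E}"

text \<open>
  An admissible policy chooses the positions of the matched stored items as a function of the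
  buffer word, the class of the incoming item, and a draw from the uniform distribution on the
  unit interval. Measurability into \<open>count_space (possible_matches E w c)\<close> includes that every
  chosen set is a possible match. The value of the policy is irrelevant when there is none.
\<close>

type_synonym 'a policy = "'a list \<Rightarrow> 'a \<Rightarrow> real \<Rightarrow> nat set"

definition admissible :: "'a set \<Rightarrow> 'a set set \<Rightarrow> 'a policy \<Rightarrow> bool" where
  "admissible V E \<Phi> \<longleftrightarrow>
     (\<forall>w\<in>buffer_words V E. \<forall>c\<in>V. possible_matches E w c \<noteq> {} \<longrightarrow>
        \<Phi> w c \<in> restrict_space borel {0..1} \<rightarrow>\<^sub>M count_space (possible_matches E w c))"

definition arrival :: "'a set set \<Rightarrow> 'a policy \<Rightarrow> 'a list \<Rightarrow> 'a \<Rightarrow> real \<Rightarrow> 'a list" where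
  "arrival E \<Phi> w c u =
     (if possible_matches E w c = {} then w @ [c] else nths w (- \<Phi> w c u))"

text \<open>
  Canonical space of the driving sequence: \<open>\<omega> n\<close> is the pair of the class of the item entering
  at time \<open>n\<close> and of the uniform draw made at that time. All pairs are independent, and so are
  the two components of each pair. The coordinate \<open>\<omega> 0\<close> is not used.
\<close>

definition driving_space :: "'a pmf \<Rightarrow> (nat \<Rightarrow> 'a \<times> real) measure" where
  "driving_space \<mu> =
     (\<Pi>\<^sub>M n\<in>UNIV. measure_pmf \<mu> \<Otimes>\<^sub>M uniform_measure lborel {0..1})"

primrec buffer ::
  "'a set set \<Rightarrow> 'a policy \<Rightarrow> 'a list \<Rightarrow> (nat \<Rightarrow> 'a \<times> real) \<Rightarrow> nat \<Rightarrow> 'a list" where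
  "buffer E \<Phi> w \<omega> 0 = w"
| "buffer E \<Phi> w \<omega> (Suc n) =
     arrival E \<Phi> (buffer E \<Phi> w \<omega> n) (fst (\<omega> (Suc n))) (snd (\<omega> (Suc n)))"

text \<open>The infimum over the empty set is \<open>\<infinity>\<close>.\<close>

definition return_time ::
  "'a set set \<Rightarrow> 'a policy \<Rightarrow> 'a list \<Rightarrow> (nat \<Rightarrow> 'a \<times> real) \<Rightarrow> ennreal" where
  "return_time E \<Phi> w \<omega> = (INF n\<in>{n. 1 \<le> n \<and> buffer E \<Phi> w \<omega> n = w}. of_nat n)"

text \<open>
  Stability is positive recurrence of the buffer chain: every state has a finite mean return
  time. Every state is accessible from the empty word, by letting its letters enter in order.
\<close>

definition stable :: "'a set \<Rightarrow> 'a set set \<Rightarrow> 'a policy \<Rightarrow> 'a pmf \<Rightarrow> bool" where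
  "stable V E \<Phi> \<mu> \<longleftrightarrow>
     (\<forall>w\<in>buffer_words V E. (\<integral>\<^sup>+\<omega>. return_time E \<Phi> w \<omega> \<partial>driving_space \<mu>) < \<infinity>)"

definition Stab :: "'a set \<Rightarrow> 'a set set \<Rightarrow> 'a policy \<Rightarrow> 'a pmf set" where
  "Stab V E \<Phi> = {\<mu> \<in> full_support_measures V. stable V E \<Phi> \<mu>}"

end

theory Submission
  imports Defs
begin

text \<open>
  Let \<open>\<mu>\<close> violate one of the inequalities defining \<open>N1\<close>, for an independent set \<open>I\<close> that is not
  \<open>\<mu>\<close>-minimal. Each match of a hyperedge \<open>H\<close> removes \<open>|H \<inter> I|\<close> items of classes in \<open>I\<close>, and the
  number of matches of \<open>H\<close> never exceeds the number of arrivals of any fixed class \<open>k H \<in> H\<close>. So if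
  \<open>k\<close> selects a minimizer of \<open>\<mu>\<close> on every hyperedge, the number of stored items of classes in \<open>I\<close>
  is at least the value of the random walk that gains \<open>1\<close> when a class of \<open>I\<close> enters and loses
  \<open>|H \<inter> I|\<close> for each \<open>H\<close> such that \<open>k H\<close> enters. In particular this walk is \<open>\<le> 0\<close> whenever the
  buffer is empty (\<open>walk_nonpos_if_buffer_empty\<close>). Its mean increment is
  \<open>\<mu>(I) - (\<Sum>H. |H \<inter> I| min \<mu>)\<close>, which is nonnegative.

  The increment can be chosen not to vanish on \<open>V\<close>: if it vanished for every selection \<open>k\<close> of
  minimizers, then \<open>I\<close> would be \<open>\<mu>\<close>-minimal (\<open>mu_minimal_if_walk_increments_vanish\<close>). Having
  nonnegative mean, it is then positive with positive probability.

  Having bounded increments, such a walk cannot be \<open>\<le> 0\<close> at an integrable stopping time \<open>T \<ge> 1\<close>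
  (\<open>hitting_time_nonpositive_not_integrable\<close>). Indeed its positive part, killed at \<open>T\<close>, has
  nondecreasing expectation, positive at time \<open>1\<close>; but it is dominated by a multiple of \<open>T\<close> and
  tends to \<open>0\<close>. This treats zero and positive drift at once. Applied to the return time to the
  empty buffer, it contradicts positive recurrence.

  The policy is only known to be well behaved for classes in \<open>V\<close> and draws in the unit interval. The
  driving sequence is therefore first forced into this range (\<open>confine\<close>), which changes it on a null
  set only and makes the buffer a measurable function of it.
\<close>

section \<open>Random walks with nonnegative drift\<close>

text \<open>
  The positive part is convex and nondecreasing, so it turns a walk with nonnegative drift into a
  submartingale. It does not appear in the statement because \<open>ennreal\<close> truncates at \<open>0\<close>.
\<close>

lemma nn_integral_pos_part_walk_step:
  fixes \<xi> :: "'b \<Rightarrow> real"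
  assumes N: "prob_space N"
    and \<xi>: "\<xi> \<in> borel_measurable N" and bounded: "\<And>x. \<bar>\<xi> x\<bar> \<le> b"
    and drift: "0 \<le> (\<integral>x. \<xi> x \<partial>N)"
  shows "ennreal y \<le> (\<integral>\<^sup>+x. ennreal (y + \<xi> x) \<partial>N)"
proof -
  interpret prob_space N by fact
  have integrable: "integrable N \<xi>"
    by (rule integrable_const_bound[where B = b]) (use bounded \<xi> in auto)
  have "norm (max 0 (y + \<xi> x)) \<le> \<bar>y\<bar> + b" for x
    using bounded[of x] by (simp add: max_def) arith
  then have pos_integrable: "integrable N (\<lambda>x. max 0 (y + \<xi> x))"
    using \<xi> by (intro integrable_const_bound[where B = "\<bar>y\<bar> + b"]) auto
  have "y \<le> (\<integral>x. y + \<xi> x \<partial>N)"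
    using integrable drift by (simp add: prob_space)
  also have "\<dots> \<le> (\<integral>x. max 0 (y + \<xi> x) \<partial>N)"
    by (intro integral_mono pos_integrable Bochner_Integration.integrable_add integrable) auto
  finally have "ennreal y \<le> ennreal (\<integral>x. max 0 (y + \<xi> x) \<partial>N)"
    by (rule ennreal_leI)
  also have "\<dots> = (\<integral>\<^sup>+x. ennreal (max 0 (y + \<xi> x)) \<partial>N)"
    by (rule nn_integral_eq_integral[OF pos_integrable, symmetric]) simp
  finally show ?thesis by simp
qed

text \<open>
  On the event that \<open>P\<close> has not occurred up to time \<open>n\<close>, the positive part of the walk at time \<open>n\<close> is at
  most \<open>b\<close> times the hitting time. Killing the walk at the hitting time loses nothing of its positive
  part, since the walk is \<open>\<le> 0\<close> there; hence the submartingale property survives the killing.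
\<close>

lemma hitting_time_nonpositive_not_integrable:
  fixes \<xi> :: "'b \<Rightarrow> real" and P :: "nat \<Rightarrow> (nat \<Rightarrow> 'b) \<Rightarrow> bool"
  assumes N: "prob_space N"
    and \<xi>[measurable]: "\<xi> \<in> borel_measurable N" and bounded: "\<And>x. \<bar>\<xi> x\<bar> \<le> b"
    and drift: "0 \<le> (\<integral>x. \<xi> x \<partial>N)"
    and up: "0 < emeasure N {x \<in> space N. 0 < \<xi> x}"
    and P[measurable]: "\<And>n. Measurable.pred (\<Pi>\<^sub>M i\<in>UNIV. N) (P n)"
    and adapted: "\<And>n \<omega> \<omega>'. (\<And>i. i \<le> n \<Longrightarrow> \<omega> i = \<omega>' i) \<Longrightarrow> P n \<omega> \<Longrightarrow> P n \<omega>'"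
    and nonpos: "\<And>n \<omega>. P n \<omega> \<Longrightarrow> (\<Sum>i=1..n. \<xi> (\<omega> i)) \<le> 0"
  shows "(\<integral>\<^sup>+\<omega>. (INF n\<in>{n. 1 \<le> n \<and> P n \<omega>}. of_nat n) \<partial>(\<Pi>\<^sub>M i\<in>UNIV. N)) = \<infinity>"
proof (rule ccontr)
  interpret N: prob_space N by fact
  interpret sequence_space N by unfold_locales
  define T :: "(nat \<Rightarrow> 'b) \<Rightarrow> ennreal"
    where "T \<omega> = (INF n\<in>{n. 1 \<le> n \<and> P n \<omega>}. of_nat n)" for \<omega>
  assume "\<not> ?thesis"
  then have T_finite: "(\<integral>\<^sup>+\<omega>. T \<omega> \<partial>S) < \<infinity>"
    by (simp add: T_def top.not_eq_extremum)
  \<comment> \<open>the index set must not depend on \<open>\<omega>\<close> for the infimum to be visibly measurable\<close>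
  have T_alt: "T = (\<lambda>\<omega>. INF n. if 1 \<le> n \<and> P n \<omega> then of_nat n else \<top>)"
  proof (intro ext antisym)
    show "T \<omega> \<le> (INF n. if 1 \<le> n \<and> P n \<omega> then of_nat n else \<top>)" for \<omega>
      unfolding T_def by (rule INF_greatest) (auto intro: INF_lower)
    show "(INF n. if 1 \<le> n \<and> P n \<omega> then of_nat n else \<top>) \<le> T \<omega>" for \<omega>
      unfolding T_def by (rule INF_greatest) (auto intro!: Inf_lower)
  qed
  have [measurable]: "T \<in> borel_measurable S"
    unfolding T_alt by measurable
  define Y where "Y n \<omega> = (\<Sum>i=1..n. \<xi> (\<omega> i))" for n and \<omega> :: "nat \<Rightarrow> 'b"
  have [measurable]: "Y n \<in> borel_measurable S" for n
    unfolding Y_def by measurable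
  define before where "before n \<omega> \<longleftrightarrow> (\<forall>k\<in>{1..n}. \<not> P k \<omega>)" for n \<omega>
  have [measurable]: "Measurable.pred S (before n)" for n
    unfolding before_def by measurable
  \<comment> \<open>the positive part of the walk, killed at the hitting time\<close>
  define Z where "Z n \<omega> = (if before n \<omega> then ennreal (Y n \<omega>) else 0)" for n \<omega>
  have [measurable]: "Z n \<in> borel_measurable S" for n
    unfolding Z_def by measurable

  have Z_Suc: "Z (Suc n) \<omega> =
      (if before n \<omega> then ennreal (Y n \<omega> + \<xi> (\<omega> (Suc n))) else 0)" for n \<omega>
  proof -
    have Y_Suc: "Y (Suc n) \<omega> = Y n \<omega> + \<xi> (\<omega> (Suc n))"
      by (simp add: Y_def)
    have "before (Suc n) \<omega> \<longleftrightarrow> before n \<omega> \<and> \<not> P (Suc n) \<omega>"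
      by (simp add: before_def atLeastAtMostSuc_conv conj_commute)
    moreover have "Y (Suc n) \<omega> \<le> 0" if "P (Suc n) \<omega>"
      using nonpos[OF that] by (simp add: Y_def)
    ultimately show ?thesis
      by (auto simp: Z_def Y_Suc ennreal_neg)
  qed

  have Z_mono: "(\<integral>\<^sup>+\<omega>. Z n \<omega> \<partial>S) \<le> (\<integral>\<^sup>+\<omega>. Z (Suc n) \<omega> \<partial>S)" for n
  proof -
    \<comment> \<open>cut the sequence after coordinate \<open>n\<close>: the next increment starts an independent copy\<close>
    let ?c = "\<lambda>(\<omega>, \<omega>'). comb_seq (Suc n) \<omega> \<omega>'"
    have prefix: "(if before n (comb_seq (Suc n) \<omega> \<omega>') then g (Y n (comb_seq (Suc n) \<omega> \<omega>')) else 0)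
        = (if before n \<omega> then g (Y n \<omega>) else (0::ennreal))" for \<omega> \<omega>' g
    proof -
      have "P k (comb_seq (Suc n) \<omega> \<omega>') \<longleftrightarrow> P k \<omega>" if "k \<le> n" for k
        by (rule iffI; erule adapted[rotated]) (use that in \<open>auto simp: comb_seq_def\<close>)
      then have "before n (comb_seq (Suc n) \<omega> \<omega>') \<longleftrightarrow> before n \<omega>"
        by (auto simp: before_def)
      moreover have "Y n (comb_seq (Suc n) \<omega> \<omega>') = Y n \<omega>"
        unfolding Y_def by (intro sum.cong) (auto simp: comb_seq_def)
      ultimately show ?thesis by simp
    qed
    have step: "ennreal y \<le> (\<integral>\<^sup>+\<omega>'. ennreal (y + \<xi> (\<omega>' 0)) \<partial>S)" for y
    proof -
      have "ennreal y \<le> (\<integral>\<^sup>+x. ennreal (y + \<xi> x) \<partial>distr S N (\<lambda>\<omega>. \<omega> 0))"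
        unfolding PiM_component[OF UNIV_I]
        by (rule nn_integral_pos_part_walk_step[OF N \<xi> bounded drift])
      also have "\<dots> = (\<integral>\<^sup>+\<omega>'. ennreal (y + \<xi> (\<omega>' 0)) \<partial>S)"
        by (rule nn_integral_distr) measurable
      finally show ?thesis .
    qed
    have "(\<integral>\<^sup>+\<omega>. Z n \<omega> \<partial>S) \<le> (\<integral>\<^sup>+\<omega>. \<integral>\<^sup>+\<omega>'. Z (Suc n) (comb_seq (Suc n) \<omega> \<omega>') \<partial>S \<partial>S)"
    proof (rule nn_integral_mono)
      fix \<omega> :: "nat \<Rightarrow> 'b"
      have next_coordinate: "comb_seq (Suc n) \<omega> \<omega>' (Suc n) = \<omega>' 0" for \<omega>'
        by (simp add: comb_seq_def)
      have "Z (Suc n) (comb_seq (Suc n) \<omega> \<omega>') =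
          (if before n \<omega> then ennreal (Y n \<omega> + \<xi> (\<omega>' 0)) else 0)" for \<omega>'
        unfolding Z_Suc next_coordinate
        by (rule prefix[of _ _ "\<lambda>y. ennreal (y + \<xi> (\<omega>' 0))"])
      then have "(\<integral>\<^sup>+\<omega>'. Z (Suc n) (comb_seq (Suc n) \<omega> \<omega>') \<partial>S) =
          (if before n \<omega> then \<integral>\<^sup>+\<omega>'. ennreal (Y n \<omega> + \<xi> (\<omega>' 0)) \<partial>S else 0)"
        by simp
      then show "Z n \<omega> \<le> (\<integral>\<^sup>+\<omega>'. Z (Suc n) (comb_seq (Suc n) \<omega> \<omega>') \<partial>S)"
        using step by (simp add: Z_def)
    qed
    also have "\<dots> = (\<integral>\<^sup>+p. Z (Suc n) (?c p) \<partial>(S \<Otimes>\<^sub>M S))"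
      by (subst P.nn_integral_fst[symmetric]) (auto simp: split_beta')
    also have "\<dots> = (\<integral>\<^sup>+\<omega>. Z (Suc n) \<omega> \<partial>distr (S \<Otimes>\<^sub>M S) S ?c)"
      by (rule nn_integral_distr[symmetric]) measurable
    finally show ?thesis
      by (simp add: PiM_comb_seq)
  qed
  have "mono (\<lambda>n. \<integral>\<^sup>+\<omega>. Z n \<omega> \<partial>S)"
    using Z_mono by (intro mono_iff_le_Suc[THEN iffD2]) auto
  then have Z_ge: "(\<integral>\<^sup>+\<omega>. Z 1 \<omega> \<partial>S) \<le> (\<integral>\<^sup>+\<omega>. Z (Suc n) \<omega> \<partial>S)" for n
    by (auto dest: monoD[where x = 1 and y = "Suc n"])

  have "(\<integral>\<^sup>+\<omega>. Z 1 \<omega> \<partial>S) = (\<integral>\<^sup>+x. ennreal (\<xi> x) \<partial>distr S N (\<lambda>\<omega>. \<omega> 1))"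
    using Z_Suc[of 0] by (subst nn_integral_distr) (auto simp: before_def Y_def intro!: nn_integral_cong)
  also have "\<dots> = (\<integral>\<^sup>+x. ennreal (\<xi> x) \<partial>N)"
    by (subst PiM_component) auto
  also have "\<dots> > 0"
  proof -
    have "{x \<in> space N. ennreal (\<xi> x) \<noteq> 0} = {x \<in> space N. 0 < \<xi> x}"
      by (auto simp: ennreal_eq_0_iff)
    then have "(\<integral>\<^sup>+x. ennreal (\<xi> x) \<partial>N) \<noteq> 0"
      using up by (subst nn_integral_0_iff) auto
    then show ?thesis by (simp add: zero_less_iff_neq_zero)
  qed
  finally have Z1_pos: "(\<integral>\<^sup>+\<omega>. Z 1 \<omega> \<partial>S) > 0" .

  have "b \<ge> 0"
    using bounded[of undefined] by linarith
  have dominated: "Z n \<omega> \<le> ennreal b * T \<omega>" for n \<omega>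
  proof (cases "before n \<omega>")
    case True
    have "Y n \<omega> \<le> (\<Sum>i=1..n. b)"
      unfolding Y_def by (intro sum_mono) (use bounded abs_le_D1 in blast)
    then have "Y n \<omega> \<le> b * real n"
      by (simp add: mult.commute)
    then have "Z n \<omega> \<le> ennreal (b * real n)"
      using True by (simp add: Z_def ennreal_leI)
    also have "\<dots> = ennreal b * of_nat n"
      using \<open>b \<ge> 0\<close> by (simp add: ennreal_mult ennreal_of_nat_eq_real_of_nat)
    also have "of_nat n \<le> T \<omega>"
      unfolding T_def
    proof (rule INF_greatest)
      fix m assume "m \<in> {m. 1 \<le> m \<and> P m \<omega>}"
      then have "n < m"
        using True by (auto simp: before_def not_less[symmetric])
      then show "(of_nat n :: ennreal) \<le> of_nat m" by simp
    qed
    finally show ?thesis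
      by (simp add: mult_left_mono)
  qed (simp add: Z_def)
  have "(\<lambda>n. \<integral>\<^sup>+\<omega>. Z n \<omega> \<partial>S) \<longlonglongrightarrow> (\<integral>\<^sup>+\<omega>. 0 \<partial>S)"
  proof (rule nn_integral_dominated_convergence[where w = "\<lambda>\<omega>. ennreal b * T \<omega>"])
    show "(\<integral>\<^sup>+\<omega>. ennreal b * T \<omega> \<partial>S) < \<infinity>"
      using T_finite by (subst nn_integral_cmult) (auto simp: ennreal_mult_less_top)
    have "AE \<omega> in S. T \<omega> \<noteq> \<infinity>"
      using T_finite by (intro nn_integral_PInf_AE) auto
    then show "AE \<omega> in S. (\<lambda>n. Z n \<omega>) \<longlonglongrightarrow> 0"
    proof eventually_elim
      case (elim \<omega>)
      then obtain m where "1 \<le> m" "P m \<omega>"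
        by (force simp: T_def)
      then have "eventually (\<lambda>n. Z n \<omega> = 0) sequentially"
        by (intro eventually_sequentiallyI[of m]) (auto simp: Z_def before_def)
      then show ?case
        by (rule tendsto_eventually)
    qed
  qed (use dominated in auto)
  then have "(\<lambda>n. \<integral>\<^sup>+\<omega>. Z (Suc n) \<omega> \<partial>S) \<longlonglongrightarrow> 0"
    by (simp add: LIMSEQ_Suc[where f = "\<lambda>n. \<integral>\<^sup>+\<omega>. Z n \<omega> \<partial>S"])
  then have "(\<integral>\<^sup>+\<omega>. Z 1 \<omega> \<partial>S) \<le> 0"
    by (rule LIMSEQ_le_const) (use Z_ge in auto)
  then show False
    using Z1_pos by simp
qed

section \<open>Conservation of items in the buffer\<close>

lemma count_list_nths:
  "count_list (nths w A) v = card {i. i < length w \<and> i \<in> A \<and> w ! i = v}"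
proof (induction w rule: rev_induct)
  case (snoc x w)
  have "{i. i < length (w @ [x]) \<and> i \<in> A \<and> (w @ [x]) ! i = v} =
      {i. i < length w \<and> i \<in> A \<and> w ! i = v} \<union> (if length w \<in> A \<and> x = v then {length w} else {})"
    by (auto simp: nth_append less_Suc_eq)
  then show ?case
    using snoc by (auto simp: nths_append)
qed simp

text \<open>
  The positions of a match carry pairwise distinct classes, so a match removes at most one item
  per class.
\<close>

lemma count_list_match:
  assumes "S \<in> possible_matches E w c"
  shows "count_list w v = count_list (nths w (- S)) v + (if v \<in> (!) w ` S then 1 else 0)"
proof -
  have S: "S \<subseteq> {..<length w}" and inj: "inj_on ((!) w) S"
    using assms by (auto simp: possible_matches_def)
  have "{i. i < length w \<and> i \<in> S \<and> w ! i = v} = {i \<in> S. w ! i = v}"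
    using S by auto
  also have "card \<dots> = (if v \<in> (!) w ` S then 1 else 0)"
  proof (cases "v \<in> (!) w ` S")
    case True
    then obtain i where "i \<in> S" "w ! i = v" by auto
    then have "{i \<in> S. w ! i = v} = {i}"
      using inj by (auto dest: inj_onD)
    then show ?thesis using True by simp
  next
    case False
    then have "{i \<in> S. w ! i = v} = {}" by auto
    then show ?thesis using False by (metis card.empty)
  qed
  finally have matched: "card {i. i < length w \<and> i \<in> S \<and> w ! i = v} = \<dots>" .
  have "count_list w v = count_list (nths w UNIV) v"
    by (simp add: nths_all)
  also have "\<dots> = card ({i. i < length w \<and> i \<in> - S \<and> w ! i = v} \<union>
      {i. i < length w \<and> i \<in> S \<and> w ! i = v})"
    unfolding count_list_nths by (rule arg_cong[where f = card]) auto
  also have "\<dots> = card {i. i < length w \<and> i \<in> - S \<and> w ! i = v} +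
      card {i. i < length w \<and> i \<in> S \<and> w ! i = v}"
    by (rule card_Un_disjoint) auto
  finally show ?thesis
    unfolding matched count_list_nths .
qed

lemma admissible_possible_match:
  assumes "admissible V E \<Phi>" "w \<in> buffer_words V E" "c \<in> V" "u \<in> {0..1}"
    and "possible_matches E w c \<noteq> {}"
  shows "\<Phi> w c u \<in> possible_matches E w c"
proof -
  have "\<Phi> w c \<in> restrict_space borel {0..1} \<rightarrow>\<^sub>M count_space (possible_matches E w c)"
    using assms by (auto simp: admissible_def)
  from measurable_space[OF this, of u] show ?thesis
    using assms(4) by simp
qed

text \<open>
  The buffer may hold several items of the same class, whereas a match consists of positions: one
  position is selected for each class.
\<close>

lemma exists_possible_match:
  assumes "H \<in> E" "c \<in> H" "H - {c} \<subseteq> set w"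
  shows "possible_matches E w c \<noteq> {}"
proof -
  have "\<exists>i. i < length w \<and> w ! i = v" if "v \<in> H - {c}" for v
    using that assms(3) by (metis in_set_conv_nth subsetD)
  then obtain p where p: "\<And>v. v \<in> H - {c} \<Longrightarrow> p v < length w \<and> w ! p v = v"
    by metis
  have "(!) w ` p ` (H - {c}) = H - {c}"
    using p by (force simp: image_image)
  moreover have "inj_on ((!) w) (p ` (H - {c}))"
    using p by (auto simp: inj_on_def)
  ultimately have "p ` (H - {c}) \<in> possible_matches E w c"
    using p assms by (auto simp: possible_matches_def insert_absorb)
  then show ?thesis by auto
qed

lemma arrival_in_buffer_words:
  assumes "admissible V E \<Phi>" and w: "w \<in> buffer_words V E" and "c \<in> V" "u \<in> {0..1}"
  shows "arrival E \<Phi> w c u \<in> buffer_words V E"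
proof (cases "possible_matches E w c = {}")
  case True
  have "\<exists>k\<in>H. k \<notin> set (w @ [c])" if "H \<in> E" for H
  proof (rule ccontr)
    assume "\<not> ?thesis"
    then have full: "H \<subseteq> insert c (set w)" by auto
    moreover have "\<not> H \<subseteq> set w"
      using w \<open>H \<in> E\<close> by (auto simp: buffer_words_def)
    ultimately have "c \<in> H" by auto
    moreover have "H - {c} \<subseteq> set w" using full by auto
    ultimately show False
      using exists_possible_match \<open>H \<in> E\<close> True by metis
  qed
  then show ?thesis
    using True w \<open>c \<in> V\<close> by (auto simp: arrival_def buffer_words_def)
next
  case False
  have "set (nths w (- \<Phi> w c u)) \<subseteq> set w"
    by (rule set_nths_subset)
  then show ?thesis
    using False w unfolding arrival_def buffer_words_def by (simp; blast)
qed

text \<open>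
  Conservation of items, separately for each class: \<open>d H\<close> is the number of matches of \<open>H\<close> performed
  at this arrival, so \<open>d\<close> is either zero or the indicator of a single hyperedge.
\<close>

lemma arrival_balance:
  assumes "finite E" "admissible V E \<Phi>" "w \<in> buffer_words V E" "c \<in> V" "u \<in> {0..1}"
  shows "\<exists>d :: 'a set \<Rightarrow> nat. \<forall>v. count_list w v + (if c = v then 1 else 0) =
    count_list (arrival E \<Phi> w c u) v + (\<Sum>H\<in>{H \<in> E. v \<in> H}. d H)"
proof (cases "possible_matches E w c = {}")
  case True
  then show ?thesis
    by (intro exI[of _ "\<lambda>_. 0"]) (simp add: arrival_def)
next
  case False
  define S where "S = \<Phi> w c u"
  have S: "S \<in> possible_matches E w c"
    unfolding S_def using admissible_possible_match assms(2-5) False by metis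
  define K where "K = insert c ((!) w ` S)"
  have K: "K \<in> E" and c: "c \<notin> (!) w ` S"
    using S by (auto simp: possible_matches_def K_def)
  have "(\<Sum>H\<in>{H \<in> E. v \<in> H}. if H = K then 1 else 0) = (if v \<in> K then 1 else 0 :: nat)" for v
    using K \<open>finite E\<close> by (simp add: sum.delta)
  then show ?thesis
    using False c count_list_match[OF S]
    by (intro exI[of _ "\<lambda>H. if H = K then 1 else 0"]) (auto simp: arrival_def S_def[symmetric] K_def)
qed

lemma buffer_in_buffer_words:
  assumes "admissible V E \<Phi>" "w \<in> buffer_words V E" "\<And>i. \<omega> i \<in> V \<times> {0..1}"
  shows "buffer E \<Phi> w \<omega> n \<in> buffer_words V E"
proof (induction n)
  case (Suc n)
  have "fst (\<omega> (Suc n)) \<in> V" "snd (\<omega> (Suc n)) \<in> {0..1}"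
    using assms(3)[of "Suc n"] by auto
  then show ?case
    using arrival_in_buffer_words[OF assms(1) Suc] by simp
qed (use assms in simp)

text \<open>
  Conservation of items up to time \<open>n\<close>, where \<open>D H\<close> counts the matches of \<open>H\<close>. The policy
  influences the class counts only through \<open>D\<close>.
\<close>

lemma buffer_balance:
  assumes "finite E" "admissible V E \<Phi>" "[] \<in> buffer_words V E"
    and \<omega>: "\<And>i. \<omega> i \<in> V \<times> {0..1}"
  shows "\<exists>D :: 'a set \<Rightarrow> nat. \<forall>v. card {i \<in> {1..n}. fst (\<omega> i) = v} =
    count_list (buffer E \<Phi> [] \<omega> n) v + (\<Sum>H\<in>{H \<in> E. v \<in> H}. D H)"
proof (induction n)
  case 0
  show ?case by (intro exI[of _ "\<lambda>_. 0"]) simp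
next
  case (Suc n)
  define w where "w = buffer E \<Phi> [] \<omega> n"
  define c where "c = fst (\<omega> (Suc n))"
  obtain D where D: "\<And>v. card {i \<in> {1..n}. fst (\<omega> i) = v} =
      count_list w v + (\<Sum>H\<in>{H \<in> E. v \<in> H}. D H)"
    using Suc unfolding w_def by blast
  have "w \<in> buffer_words V E"
    unfolding w_def by (rule buffer_in_buffer_words[OF assms(2,3) \<omega>])
  moreover have "c \<in> V" "snd (\<omega> (Suc n)) \<in> {0..1}"
    using \<omega>[of "Suc n"] by (auto simp: c_def)
  ultimately have "\<exists>d :: 'a set \<Rightarrow> nat. \<forall>v. count_list w v + (if c = v then 1 else 0) =
      count_list (buffer E \<Phi> [] \<omega> (Suc n)) v + (\<Sum>H\<in>{H \<in> E. v \<in> H}. d H)"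
    unfolding buffer.simps w_def[symmetric] c_def[symmetric] by (rule arrival_balance[OF assms(1,2)])
  then obtain d where d: "\<And>v. count_list w v + (if c = v then 1 else 0) =
      count_list (buffer E \<Phi> [] \<omega> (Suc n)) v + (\<Sum>H\<in>{H \<in> E. v \<in> H}. d H)"
    by blast
  have counted: "card {i \<in> {1..Suc n}. fst (\<omega> i) = v} =
      card {i \<in> {1..n}. fst (\<omega> i) = v} + (if c = v then 1 else 0)" for v
  proof -
    have "{i \<in> {1..Suc n}. fst (\<omega> i) = v} =
        {i \<in> {1..n}. fst (\<omega> i) = v} \<union> (if c = v then {Suc n} else {})"
      by (auto simp: c_def le_Suc_eq)
    then show ?thesis by auto
  qed
  show ?case
  proof (intro exI allI)
    show "card {i \<in> {1..Suc n}. fst (\<omega> i) = v} = count_list (buffer E \<Phi> [] \<omega> (Suc n)) v +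
        (\<Sum>H\<in>{H \<in> E. v \<in> H}. D H + d H)" for v
      using counted[of v] D[of v] d[of v] unfolding sum.distrib by linarith
  qed
qed

text \<open>
  Summed over the arrivals since the buffer was empty, this is a lower bound for the number of stored
  items of classes in \<open>I\<close>, provided that \<open>k\<close> selects a class in each hyperedge.
\<close>

definition walk_increment :: "'a set set \<Rightarrow> 'a set \<Rightarrow> ('a set \<Rightarrow> 'a) \<Rightarrow> 'a \<Rightarrow> real" where
  "walk_increment E I k c =
     indicator I c - (\<Sum>H\<in>E. real (card (H \<inter> I)) * indicator {k H} c)"

text \<open>
  With an empty buffer, every item of a class in \<open>I\<close> has been matched, so the arrivals in \<open>I\<close> number
  \<open>\<Sum>H. |H \<inter> I| D H\<close>, where \<open>D H\<close> counts the matches of \<open>H\<close>. Each of these matches used up an item of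
  class \<open>k H\<close>.
\<close>

lemma walk_nonpos_if_buffer_empty:
  assumes "finite E" "finite I" "\<And>H. H \<in> E \<Longrightarrow> k H \<in> H"
    and "admissible V E \<Phi>" "[] \<in> buffer_words V E" "\<And>i. \<omega> i \<in> V \<times> {0..1}"
    and empty: "buffer E \<Phi> [] \<omega> n = []"
  shows "(\<Sum>i=1..n. walk_increment E I k (fst (\<omega> i))) \<le> 0"
proof -
  define A where "A v = card {i \<in> {1..n}. fst (\<omega> i) = v}" for v
  obtain D :: "'a set \<Rightarrow> nat" where A: "\<And>v. A v = (\<Sum>H\<in>{H \<in> E. v \<in> H}. D H)"
    using buffer_balance[where \<omega> = \<omega> and n = n, OF assms(1,4-6)] unfolding A_def empty by auto
  have count: "(\<Sum>i=1..n. indicator {v} (fst (\<omega> i))) = real (A v)" for v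
    unfolding A_def by (simp add: indicator_def sum.If_cases Int_def conj_commute)
  have "(\<Sum>i=1..n. indicator I (fst (\<omega> i))) = (\<Sum>i=1..n. \<Sum>v\<in>I. indicator {v} (fst (\<omega> i)) :: real)"
    using \<open>finite I\<close> by (intro sum.cong) (auto simp: indicator_def)
  also have "\<dots> = (\<Sum>v\<in>I. real (A v))"
    by (subst sum.swap) (simp only: count)
  also have "\<dots> = (\<Sum>v\<in>I. \<Sum>H | H \<in> E \<and> v \<in> H. real (D H))"
    by (simp add: A)
  also have "\<dots> = (\<Sum>H\<in>E. \<Sum>v | v \<in> I \<and> v \<in> H. real (D H))"
    using assms(2,1) by (rule sum.swap_restrict)
  also have "\<dots> = (\<Sum>H\<in>E. real (card (H \<inter> I)) * real (D H))"
    by (simp add: Int_def conj_commute)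
  also have "\<dots> \<le> (\<Sum>H\<in>E. real (card (H \<inter> I)) * real (A (k H)))"
  proof (intro sum_mono mult_left_mono)
    fix H assume "H \<in> E"
    then have "D H \<le> A (k H)"
      unfolding A using assms(1,3) by (intro member_le_sum) auto
    then show "real (D H) \<le> real (A (k H))" by simp
  qed simp
  also have "\<dots> = (\<Sum>i=1..n. \<Sum>H\<in>E. real (card (H \<inter> I)) * indicator {k H} (fst (\<omega> i)))"
    by (subst sum.swap) (simp only: sum_distrib_left[symmetric] count)
  finally show ?thesis
    by (simp add: walk_increment_def sum_subtractf)
qed

section \<open>Nondegenerate increments\<close>

lemma hyperedge_nonempty:
  assumes "hypergraph V E" "V \<noteq> {}" "H \<in> E"
  shows "H \<noteq> {}"
  using assms unfolding hypergraph_def by blast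

lemma minimizers_iff:
  assumes "finite H"
  shows "j \<in> minimizers \<mu> H \<longleftrightarrow> j \<in> H \<and> pmf \<mu> j = Min (pmf \<mu> ` H)"
proof -
  have "j \<in> minimizers \<mu> H \<longleftrightarrow> j \<in> H \<and> (\<forall>i\<in>H. pmf \<mu> j \<le> pmf \<mu> i)"
    by (auto simp: minimizers_def is_arg_min_linorder)
  then show ?thesis
    using assms by (auto intro!: Min_eqI[symmetric])
qed

lemma exists_minimizer:
  assumes "finite H" "H \<noteq> {}"
  shows "\<exists>j. j \<in> minimizers \<mu> H"
proof -
  have "Min (pmf \<mu> ` H) \<in> pmf \<mu> ` H"
    using assms by (intro Min_in) auto
  then show ?thesis
    using assms by (auto simp: minimizers_iff image_iff eq_commute)
qed

text \<open>
  A vanishing increment at \<open>c \<notin> I\<close> says that no hyperedge meeting \<open>I\<close> selects \<open>c\<close>; at \<open>c \<in> I\<close> it says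
  that a single hyperedge meeting \<open>I\<close> selects \<open>c\<close>, and that it meets \<open>I\<close> only once. So each hyperedge
  meeting \<open>I\<close> meets it exactly in its selected class, and a class of \<open>I\<close> is selected by all the
  hyperedges containing it, hence has degree \<open>1\<close>. A second minimizer on \<open>H\<close> could be selected
  instead, and would then be the intersection with \<open>I\<close> as well.
\<close>

lemma mu_minimal_if_walk_increments_vanish:
  assumes hyp: "hypergraph V E" and "V \<noteq> {}" and ind: "independent_set V E I"
    and vanish: "\<And>k c. (\<And>H. H \<in> E \<Longrightarrow> k H \<in> minimizers \<mu> H) \<Longrightarrow> c \<in> V \<Longrightarrow> walk_increment E I k c = 0"
  shows "mu_minimal V E \<mu> I"
proof -
  have "finite V" "finite E" and union: "\<Union>E = V"
    using hyp by (auto simp: hypergraph_def)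
  have finE: "finite H" "H \<subseteq> V" if "H \<in> E" for H
  proof -
    show "H \<subseteq> V" using that union by auto
    then show "finite H" using \<open>finite V\<close> by (rule finite_subset)
  qed
  have "\<exists>j. j \<in> minimizers \<mu> H" if "H \<in> E" for H
    using that finE hyperedge_nonempty[OF hyp \<open>V \<noteq> {}\<close>] exists_minimizer by metis
  then obtain k where k: "\<And>H. H \<in> E \<Longrightarrow> k H \<in> minimizers \<mu> H"
    by metis
  have total: "(\<Sum>H\<in>{H \<in> E. l H = c}. card (H \<inter> I)) = (if c \<in> I then 1 else 0)"
    if "\<And>H. H \<in> E \<Longrightarrow> l H \<in> minimizers \<mu> H" "c \<in> V" for l c
  proof -
    have "real (\<Sum>H\<in>{H \<in> E. l H = c}. card (H \<inter> I)) =
        (\<Sum>H\<in>E. if l H = c then real (card (H \<inter> I)) else 0)"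
      using sum.inter_filter[OF \<open>finite E\<close>] by simp
    also have "\<dots> = (\<Sum>H\<in>E. real (card (H \<inter> I)) * indicator {l H} c)"
      by (intro sum.cong) (auto simp: indicator_def)
    also have "\<dots> = indicator I c"
      using vanish[OF that] by (simp add: walk_increment_def)
    also have "\<dots> = real (if c \<in> I then 1 else 0)"
      by simp
    finally show ?thesis by (simp only: of_nat_eq_iff)
  qed
  have meet: "H \<inter> I = {l H}"
    if l: "\<And>H. H \<in> E \<Longrightarrow> l H \<in> minimizers \<mu> H" and H: "H \<in> E" "H \<inter> I \<noteq> {}" for l H
  proof -
    have lH: "l H \<in> H"
      using l H finE by (simp add: minimizers_iff)
    have "l H \<in> V"
      using lH finE(2)[OF H(1)] by auto
    have "card (H \<inter> I) \<le> (\<Sum>K\<in>{K \<in> E. l K = l H}. card (K \<inter> I))"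
      using \<open>finite E\<close> H by (intro member_le_sum) auto
    also have "\<dots> = (if l H \<in> I then 1 else 0)"
      by (rule total[OF l \<open>l H \<in> V\<close>])
    finally have "card (H \<inter> I) \<le> (if l H \<in> I then 1 else 0)" .
    moreover have "card (H \<inter> I) > 0"
      using H finE by (simp add: card_gt_0_iff)
    ultimately have "l H \<in> I" "card (H \<inter> I) = 1"
      by (auto split: if_splits)
    then have "l H \<in> H \<inter> I" and "is_singleton (H \<inter> I)"
      using lH by (auto simp: is_singleton_altdef)
    then show ?thesis
      by (metis is_singletonE singletonD)
  qed
  have "H \<inter> I = {} \<or> (\<exists>v. H \<inter> I = {v} \<and> degree E v = 1 \<and> minimizers \<mu> H = {v})"
    if H: "H \<in> E" for H
  proof (cases "H \<inter> I = {}")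
    case False
    define v where "v = k H"
    have HI: "H \<inter> I = {v}"
      unfolding v_def by (rule meet[of k, OF k H False])
    then have "v \<in> I" "v \<in> V"
      using finE(2)[OF H] by auto
    have "{K \<in> E. v \<in> K} = {H}"
    proof -
      \<comment> \<open>every hyperedge containing \<open>v\<close> selects \<open>v\<close>, and the increment at \<open>v\<close> leaves room for one only\<close>
      have owned: "k K = v \<and> card (K \<inter> I) = 1" if "K \<in> E" "v \<in> K" for K
      proof -
        have KI: "K \<inter> I = {k K}"
          by (rule meet[of k, OF k]) (use that \<open>v \<in> I\<close> in auto)
        have "v \<in> K \<inter> I"
          using that \<open>v \<in> I\<close> by simp
        then have "k K = v"
          unfolding KI by simp
        then show ?thesis
          using KI by simp
      qed
      have eq: "{K \<in> E. k K = v} = {K \<in> E. v \<in> K}"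
        using owned k minimizers_iff[OF finE(1)] by blast
      have "(\<Sum>K\<in>{K \<in> E. v \<in> K}. card (K \<inter> I)) = 1"
        using total[of k v, OF k \<open>v \<in> V\<close>] \<open>v \<in> I\<close> unfolding eq by simp
      then have "is_singleton {K \<in> E. v \<in> K}"
        using owned by (simp add: is_singleton_altdef)
      moreover have "H \<in> {K \<in> E. v \<in> K}"
        using H HI by auto
      ultimately show ?thesis
        by (metis is_singletonE singletonD)
    qed
    then have "degree E v = 1"
      by (simp add: degree_def)
    moreover have "minimizers \<mu> H = {v}"
    proof -
      have "j = v" if "j \<in> minimizers \<mu> H" for j
      proof -
        \<comment> \<open>reroute the selection on \<open>H\<close> to the competing minimizer\<close>
        have "(k(H := j)) K \<in> minimizers \<mu> K" if "K \<in> E" for K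
          using k[OF that] \<open>j \<in> minimizers \<mu> H\<close> by simp
        then have "H \<inter> I = {(k(H := j)) H}"
          by (rule meet[OF _ H False])
        with HI show ?thesis by simp
      qed
      then show ?thesis
        using k[OF H] unfolding v_def by blast
    qed
    ultimately show ?thesis
      using HI by blast
  qed simp
  then show ?thesis
    using ind by (simp add: mu_minimal_def)
qed

lemma expectation_walk_increment:
  assumes "finite E"
  shows "measure_pmf.expectation \<mu> (walk_increment E I k) =
    measure_pmf.prob \<mu> I - (\<Sum>H\<in>E. real (card (H \<inter> I)) * pmf \<mu> (k H))"
proof -
  have [simp]: "integrable (measure_pmf \<mu>) (indicator A :: _ \<Rightarrow> real)" for A
    by (rule measure_pmf.integrable_const_bound[where B = 1]) auto
  show ?thesis
    unfolding walk_increment_def by (simp add: measure_pmf_single)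
qed

lemma abs_walk_increment_le:
  "\<bar>walk_increment E I k c\<bar> \<le> 1 + (\<Sum>H\<in>E. real (card (H \<inter> I)))"
proof -
  have "(\<Sum>H\<in>E. real (card (H \<inter> I)) * indicator {k H} c) \<le> (\<Sum>H\<in>E. real (card (H \<inter> I)))"
    by (intro sum_mono) (auto simp: indicator_def)
  moreover have "(\<Sum>H\<in>E. real (card (H \<inter> I)) * indicator {k H} c) \<ge> 0"
    by (intro sum_nonneg) auto
  moreover have "0 \<le> (indicator I c :: real)" "(indicator I c :: real) \<le> 1"
    by (auto simp: indicator_def)
  ultimately show ?thesis
    unfolding walk_increment_def by linarith
qed

text \<open>A nonpositive function with nonnegative mean vanishes on the support.\<close>

lemma exists_pos_if_expectation_nonneg:
  fixes f :: "'a \<Rightarrow> real"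
  assumes "finite (set_pmf \<mu>)" "0 \<le> measure_pmf.expectation \<mu> f" "c \<in> set_pmf \<mu>" "f c \<noteq> 0"
  shows "\<exists>c\<in>set_pmf \<mu>. 0 < f c"
proof (rule ccontr)
  assume "\<not> ?thesis"
  then have nonpos: "f x \<le> 0" if "x \<in> set_pmf \<mu>" for x
    using that by force
  have "measure_pmf.expectation \<mu> f = (\<Sum>x\<in>set_pmf \<mu>. f x * pmf \<mu> x)"
    using assms(1) by (subst integral_measure_pmf_real) auto
  also have "\<dots> < (\<Sum>x\<in>set_pmf \<mu>. 0)"
    using assms nonpos
    by (intro sum_strict_mono_ex1)
      (auto intro!: mult_nonpos_nonneg bexI[of _ c] simp: mult_less_0_iff less_le pmf_eq_0_set_pmf)
  finally show False using assms(2) by simp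
qed

section \<open>Measurability of the buffer\<close>

definition driving_law :: "'a pmf \<Rightarrow> ('a \<times> real) measure" where
  "driving_law \<mu> = measure_pmf \<mu> \<Otimes>\<^sub>M uniform_measure lborel {0..1}"

lemma driving_space_eq: "driving_space \<mu> = (\<Pi>\<^sub>M n\<in>UNIV. driving_law \<mu>)"
  by (simp add: driving_space_def driving_law_def)

lemma measurable_fst_driving_law: "fst \<in> driving_law \<mu> \<rightarrow>\<^sub>M count_space UNIV"
proof -
  have "fst \<in> driving_law \<mu> \<rightarrow>\<^sub>M measure_pmf \<mu>"
    unfolding driving_law_def by (rule measurable_fst)
  then show ?thesis by simp
qed

lemma measurable_snd_driving_law: "snd \<in> borel_measurable (driving_law \<mu>)"
proof -
  have "sets (uniform_measure lborel {0..1::real}) = sets borel"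
    by simp
  moreover have "snd \<in> driving_law \<mu> \<rightarrow>\<^sub>M uniform_measure lborel {0..1}"
    unfolding driving_law_def by (rule measurable_snd)
  ultimately show ?thesis
    using measurable_cong_sets[OF refl] by blast
qed

lemma prob_space_uniform: "prob_space (uniform_measure lborel {0..1::real})"
  by (rule prob_space_uniform_measure) auto

lemma prob_space_driving_law: "prob_space (driving_law \<mu>)"
  unfolding driving_law_def
  by (intro prob_space_pair prob_space_uniform measure_pmf.prob_space_axioms)

lemma distr_driving_law_fst: "distr (driving_law \<mu>) (measure_pmf \<mu>) fst = measure_pmf \<mu>"
  unfolding driving_law_def by (rule prob_space.distr_pair_fst[OF prob_space_uniform])

text \<open>
  Outside \<open>V \<times> {0..1}\<close> the policy is arbitrary and need not be measurable, so the driving pairs are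
  retracted onto that set. The default class only has to lie in \<open>V\<close>.
\<close>

definition confine :: "'a set \<Rightarrow> 'a \<times> real \<Rightarrow> 'a \<times> real" where
  "confine V = map_prod (\<lambda>c. if c \<in> V then c else SOME v. v \<in> V) (\<lambda>u. max 0 (min 1 u))"

lemma confine_in: "V \<noteq> {} \<Longrightarrow> confine V x \<in> V \<times> {0..1}"
  by (cases x) (auto simp: confine_def some_in_eq)

lemma AE_confine_eq:
  assumes "set_pmf \<mu> = V"
  shows "AE x in driving_law \<mu>. confine V x = x"
proof -
  interpret U: prob_space "uniform_measure lborel {0..1::real}"
    by (rule prob_space_uniform)
  interpret pair_prob_space "measure_pmf \<mu>" "uniform_measure lborel {0..1::real}" ..
  have "fst -` V \<inter> space (driving_law \<mu>) \<inter> (snd -` {0..1} \<inter> space (driving_law \<mu>))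
      \<in> sets (driving_law \<mu>)"
    by (intro sets.Int measurable_sets[OF measurable_fst_driving_law]
        measurable_sets[OF measurable_snd_driving_law]) auto
  also have "fst -` V \<inter> space (driving_law \<mu>) \<inter> (snd -` {0..1} \<inter> space (driving_law \<mu>)) =
      {x \<in> space (driving_law \<mu>). fst x \<in> V \<and> 0 \<le> snd x \<and> snd x \<le> 1}"
    by auto
  finally have event: "{x \<in> space (driving_law \<mu>). fst x \<in> V \<and> 0 \<le> snd x \<and> snd x \<le> 1}
      \<in> sets (driving_law \<mu>)" .
  have "AE x in driving_law \<mu>. fst x \<in> V \<and> 0 \<le> snd x \<and> snd x \<le> 1"
    unfolding driving_law_def
  proof (rule AE_pair_measure)
    show "{x \<in> space (measure_pmf \<mu> \<Otimes>\<^sub>M uniform_measure lborel {0..1::real}).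
        fst x \<in> V \<and> 0 \<le> snd x \<and> snd x \<le> 1} \<in>
        sets (measure_pmf \<mu> \<Otimes>\<^sub>M uniform_measure lborel {0..1::real})"
      using event unfolding driving_law_def .
    have "AE u in uniform_measure lborel {0..1::real}. 0 \<le> u \<and> u \<le> 1"
      by (rule AE_uniform_measureI) auto
    then show "AE c in measure_pmf \<mu>. AE u in uniform_measure lborel {0..1::real}.
        fst (c, u) \<in> V \<and> 0 \<le> snd (c, u) \<and> snd (c, u) \<le> 1"
      using assms by (auto simp: AE_measure_pmf_iff)
  qed
  then show ?thesis
    by eventually_elim (auto simp: confine_def)
qed

lemma measurable_fst_confine:
  assumes "V \<noteq> {}"
  shows "(\<lambda>x. fst (confine V x)) \<in> driving_law \<mu> \<rightarrow>\<^sub>M count_space V"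
proof -
  have "(\<lambda>c. if c \<in> V then c else SOME v. v \<in> V) \<in> count_space UNIV \<rightarrow>\<^sub>M count_space V"
    using assms by (auto simp: some_in_eq)
  from measurable_compose[OF measurable_fst_driving_law this] show ?thesis
    by (simp add: confine_def)
qed

lemma measurable_snd_confine:
  "(\<lambda>x. snd (confine V x)) \<in> driving_law \<mu> \<rightarrow>\<^sub>M restrict_space borel {0..1}"
proof -
  note [measurable] = measurable_snd_driving_law
  show ?thesis
    unfolding confine_def snd_map_prod by (rule measurable_restrict_space2) auto
qed

lemma countable_buffer_words:
  assumes "finite V"
  shows "countable (buffer_words V E)"
proof -
  have "buffer_words V E \<subseteq> lists V"
    by (auto simp: buffer_words_def)
  then show ?thesis
    using assms countable_finite countable_lists countable_subset by metis
qed

text \<open>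
  The buffer takes countably many values and there are finitely many classes. Once the word and the
  class are fixed, the next word depends on the draw only, through the measurable choice made
  by the policy.
\<close>

lemma measurable_buffer:
  assumes "finite V" "V \<noteq> {}" and adm: "admissible V E \<Phi>" and nil: "[] \<in> buffer_words V E"
  shows "(\<lambda>\<omega>. buffer E \<Phi> [] (confine V \<circ> \<omega>) n) \<in> (\<Pi>\<^sub>M n\<in>UNIV. driving_law \<mu>) \<rightarrow>\<^sub>M
    count_space (buffer_words V E)"
proof (induction n)
  case 0
  show ?case using nil by simp
next
  case (Suc n)
  let ?S = "\<Pi>\<^sub>M n\<in>(UNIV::nat set). driving_law \<mu>"
  have coordinate: "(\<lambda>\<omega>. \<omega> (Suc n)) \<in> ?S \<rightarrow>\<^sub>M driving_law \<mu>"
    by measurable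
  have entering: "(\<lambda>\<omega>. fst (confine V (\<omega> (Suc n)))) \<in> ?S \<rightarrow>\<^sub>M count_space V"
    by (rule measurable_compose[OF coordinate measurable_fst_confine[OF \<open>V \<noteq> {}\<close>]])
  have draw: "(\<lambda>\<omega>. snd (confine V (\<omega> (Suc n)))) \<in> ?S \<rightarrow>\<^sub>M restrict_space borel {0..1}"
    by (rule measurable_compose[OF coordinate measurable_snd_confine])
  have step: "arrival E \<Phi> w c \<in> restrict_space borel {0..1} \<rightarrow>\<^sub>M count_space (buffer_words V E)"
    if "w \<in> buffer_words V E" "c \<in> V" for w c
  proof (cases "possible_matches E w c = {}")
    case True
    then have "arrival E \<Phi> w c = (\<lambda>_. w @ [c])"
      by (auto simp: arrival_def)
    moreover have "w @ [c] \<in> buffer_words V E"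
      using arrival_in_buffer_words[OF adm that, of 0] True by (simp add: arrival_def)
    ultimately show ?thesis by simp
  next
    case False
    have choice: "\<Phi> w c \<in> restrict_space borel {0..1} \<rightarrow>\<^sub>M count_space (possible_matches E w c)"
      using adm that False by (simp add: admissible_def)
    have "set (nths w A) \<subseteq> set w" for A
      by (rule set_nths_subset)
    then have "(\<lambda>A. nths w (- A)) \<in> count_space (possible_matches E w c) \<rightarrow>\<^sub>M
        count_space (buffer_words V E)"
      using that by (simp add: buffer_words_def) blast
    from measurable_compose[OF choice this] show ?thesis
      using False by (simp add: arrival_def[abs_def])
  qed
  have "(\<lambda>\<omega>. arrival E \<Phi> w (fst (confine V (\<omega> (Suc n)))) (snd (confine V (\<omega> (Suc n)))))
      \<in> ?S \<rightarrow>\<^sub>M count_space (buffer_words V E)" if "w \<in> buffer_words V E" for w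
    using measurable_compose[OF draw step[OF that]]
    by (rule measurable_compose_countable'[OF _ entering countable_finite[OF \<open>finite V\<close>]])
  from measurable_compose_countable'[OF this Suc countable_buffer_words[OF \<open>finite V\<close>]]
  show ?case unfolding buffer.simps comp_def .
qed

lemma buffer_cong:
  "(\<And>i. i \<le> n \<Longrightarrow> \<omega> i = \<omega>' i) \<Longrightarrow> buffer E \<Phi> w \<omega> n = buffer E \<Phi> w \<omega>' n"
  by (induction n) auto

lemma AE_driving_space_confine_eq:
  assumes "set_pmf \<mu> = V"
  shows "AE \<omega> in driving_space \<mu>. confine V \<circ> \<omega> = \<omega>"
proof -
  have "AE \<omega> in driving_space \<mu>. \<forall>n. confine V (\<omega> n) = \<omega> n"
    unfolding driving_space_eq AE_all_countable
    by (intro allI AE_PiM_component prob_space_driving_law AE_confine_eq assms) simp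
  then show ?thesis
    by eventually_elim auto
qed

section \<open>Necessary condition for stability\<close>

theorem proposition4p1:
  fixes V :: "'a set" and E :: "'a set set" and \<Phi> :: "'a policy"
  assumes "hypergraph V E"
    and "connected_hypergraph E"
    and "admissible V E \<Phi>"
  shows "Stab V E \<Phi> \<subseteq> N1 V E"
proof
  fix \<mu> assume "\<mu> \<in> Stab V E \<Phi>"
  then have supp: "set_pmf \<mu> = V" and stable: "stable V E \<Phi> \<mu>"
    by (auto simp: Stab_def full_support_measures_def)
  have "V \<noteq> {}"
    using supp set_pmf_not_empty by metis
  have "finite V" "finite E" and union: "\<Union>E = V"
    using assms(1) by (auto simp: hypergraph_def)
  have hyperedge: "finite H" "H \<noteq> {}" if "H \<in> E" for H
    using hyperedge_nonempty[OF assms(1) \<open>V \<noteq> {}\<close> that] that union \<open>finite V\<close>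
    by (auto intro: finite_subset[of H V])
  have nil: "[] \<in> buffer_words V E"
    using hyperedge by (auto simp: buffer_words_def)
  show "\<mu> \<in> N1 V E"
  proof (rule ccontr)
    assume "\<mu> \<notin> N1 V E"
    then obtain I where ind: "independent_set V E I" and not_minimal: "\<not> mu_minimal V E \<mu> I"
      and drift: "(\<Sum>H\<in>E. real (card (H \<inter> I)) * Min (pmf \<mu> ` H)) \<le> measure_pmf.prob \<mu> I"
      using supp by (auto simp: N1_def full_support_measures_def not_less)
    obtain k c0 where k: "\<And>H. H \<in> E \<Longrightarrow> k H \<in> minimizers \<mu> H"
      and c0: "c0 \<in> V" "walk_increment E I k c0 \<noteq> 0"
      using mu_minimal_if_walk_increments_vanish[OF assms(1) \<open>V \<noteq> {}\<close> ind] not_minimal by metis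
    have kH: "k H \<in> H" "pmf \<mu> (k H) = Min (pmf \<mu> ` H)" if "H \<in> E" for H
      using k[OF that] minimizers_iff[OF hyperedge(1)[OF that]] by auto
    have "finite I"
      using ind \<open>finite V\<close> finite_subset by (auto simp: independent_set_def)
    let ?f = "walk_increment E I k"
    have mean: "0 \<le> measure_pmf.expectation \<mu> ?f"
      using drift kH by (simp add: expectation_walk_increment \<open>finite E\<close>)
    obtain c where c: "c \<in> V" "0 < ?f c"
      using exists_pos_if_expectation_nonneg[OF _ mean] supp c0 \<open>finite V\<close> by auto

    define \<xi> where "\<xi> x = ?f (fst (confine V x))" for x
    have \<xi>_meas: "\<xi> \<in> borel_measurable (driving_law \<mu>)"
      unfolding \<xi>_def by (rule measurable_compose[OF measurable_fst_confine]) (use \<open>V \<noteq> {}\<close> in auto)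
    have fst_meas: "fst \<in> driving_law \<mu> \<rightarrow>\<^sub>M measure_pmf \<mu>"
      by (simp add: driving_law_def)
    have f_fst_meas: "(\<lambda>x. ?f (fst x)) \<in> borel_measurable (driving_law \<mu>)"
      by (rule measurable_compose[OF fst_meas]) simp
    have "(\<integral>x. \<xi> x \<partial>driving_law \<mu>) = (\<integral>x. ?f (fst x) \<partial>driving_law \<mu>)"
    proof (rule integral_cong_AE[OF \<xi>_meas f_fst_meas])
      show "AE x in driving_law \<mu>. \<xi> x = ?f (fst x)"
        using AE_confine_eq[OF supp] by eventually_elim (simp add: \<xi>_def)
    qed
    also have "\<dots> = measure_pmf.expectation \<mu> ?f"
      using integral_distr[OF fst_meas, of ?f] by (simp add: distr_driving_law_fst)
    finally have \<xi>_drift: "0 \<le> (\<integral>x. \<xi> x \<partial>driving_law \<mu>)"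
      using mean by simp
    have \<xi>_up: "0 < emeasure (driving_law \<mu>) {x \<in> space (driving_law \<mu>). 0 < \<xi> x}"
    proof -
      have "0 < emeasure (measure_pmf \<mu>) {c}"
        using c supp by (simp add: emeasure_pmf_single pmf_positive)
      also have "\<dots> = emeasure (driving_law \<mu>) (fst -` {c} \<inter> space (driving_law \<mu>))"
        by (subst distr_driving_law_fst[symmetric], rule emeasure_distr[OF fst_meas]) simp
      also have "\<dots> \<le> emeasure (driving_law \<mu>) {x \<in> space (driving_law \<mu>). 0 < \<xi> x}"
      proof (rule emeasure_mono)
        show "fst -` {c} \<inter> space (driving_law \<mu>) \<subseteq> {x \<in> space (driving_law \<mu>). 0 < \<xi> x}"
          using c by (auto simp: \<xi>_def confine_def)
        show "{x \<in> space (driving_law \<mu>). 0 < \<xi> x} \<in> sets (driving_law \<mu>)"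
          using \<xi>_meas by measurable
      qed
      finally show ?thesis .
    qed
    define P where "P n \<omega> \<longleftrightarrow> buffer E \<Phi> [] (confine V \<circ> \<omega>) n = []" for n \<omega>
    have P_measurable: "Measurable.pred (\<Pi>\<^sub>M i\<in>UNIV. driving_law \<mu>) (P n)" for n
      unfolding P_def
      by (rule measurable_compose[OF measurable_buffer[OF \<open>finite V\<close> \<open>V \<noteq> {}\<close> assms(3) nil]]) simp
    have P_adapted: "P n \<omega>'" if "\<And>i. i \<le> n \<Longrightarrow> \<omega> i = \<omega>' i" "P n \<omega>" for n \<omega> \<omega>'
      using that buffer_cong[of n "confine V \<circ> \<omega>" "confine V \<circ> \<omega>'" E \<Phi> "[]"] by (simp add: P_def)
    have P_nonpos: "(\<Sum>i=1..n. \<xi> (\<omega> i)) \<le> 0" if "P n \<omega>" for n \<omega>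
      using walk_nonpos_if_buffer_empty[OF \<open>finite E\<close> \<open>finite I\<close> kH(1) assms(3) nil, of "confine V \<circ> \<omega>" n]
        that confine_in[OF \<open>V \<noteq> {}\<close>] by (simp add: P_def \<xi>_def)
    have bounded: "\<bar>\<xi> x\<bar> \<le> 1 + (\<Sum>H\<in>E. real (card (H \<inter> I)))" for x
      unfolding \<xi>_def by (rule abs_walk_increment_le)
    have "(\<integral>\<^sup>+\<omega>. (INF n\<in>{n. 1 \<le> n \<and> P n \<omega>}. of_nat n) \<partial>driving_space \<mu>) = \<infinity>"
      unfolding driving_space_eq
    proof (rule hitting_time_nonpositive_not_integrable
        [OF prob_space_driving_law \<xi>_meas bounded \<xi>_drift \<xi>_up P_measurable])
      show "P n \<omega>'" if "\<And>i. i \<le> n \<Longrightarrow> \<omega> i = \<omega>' i" "P n \<omega>" for n \<omega> \<omega>'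
        using that by (rule P_adapted)
      show "(\<Sum>i=1..n. \<xi> (\<omega> i)) \<le> 0" if "P n \<omega>" for n \<omega>
        using that by (rule P_nonpos)
    qed
    moreover have "(\<integral>\<^sup>+\<omega>. return_time E \<Phi> [] \<omega> \<partial>driving_space \<mu>) =
        (\<integral>\<^sup>+\<omega>. (INF n\<in>{n. 1 \<le> n \<and> P n \<omega>}. of_nat n) \<partial>driving_space \<mu>)"
      using AE_driving_space_confine_eq[OF supp]
      by (intro nn_integral_cong_AE) (auto simp: P_def return_time_def elim: eventually_mono)
    ultimately show False
      using stable nil by (auto simp: stable_def)
  qed
qed

end
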